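(* Let $X$ be a locally compact Hausdorff space and let $\mathscr{P}$ be compactness. The following are equivalent: (1) $X$ is $\mathscr{P}$-connected. (2) The subspace $\beta X\setminus X$ of $\beta X$ is connected.
   Context: A zero-set of a space $X$ is a set $f^{-1}(0)$ with $f:X\to[0,1]$ continuous; a cozero-set of $X$ is the complement in $X$ of a zero-set. $\mathrm{Coz}(X)$ denotes the set of all cozero-sets of $X$. Let $\mathscr{P}$ be a topological property. A $\mathscr{P}$-separation for a space $X$ is a pair $C,D\in\mathrm{Coz}(X)$ such that: $C$ and $D$ are disjoint; neither $\mathrm{cl}_XC$ nor $\mathrm{cl}_XD$ has $\mathscr{P}$; and $X\setminus(C\cup D)\subseteq E$ for some $E\in\mathrm{Coz}(X)$ such that $\mathrm{cl}_XE$ has $\mathscr{P}$. The space $X$ is $\mathscr{P}$-disconnected if there is a $\mathscr{P}$-separation for it, and $\mathscr{P}$-connected otherwise. $\beta X$ is the Stone–Čech compactification of $X$ (with $X\subseteq\beta X$). A space is connected if it is not the union of two disjoint non-empty closed subsets; in particular the empty space is connected. *)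

theory Defs
  imports "HOL-Analysis.Analysis"
begin

definition zero_set_in :: "'a topology \<Rightarrow> 'a set \<Rightarrow> bool" where
  "zero_set_in X Z \<longleftrightarrow>
     (\<exists>f :: 'a \<Rightarrow> real. continuous_map X (top_of_set {0..1}) f \<and> Z = {x \<in> topspace X. f x = 0})"

definition Coz :: "'a topology \<Rightarrow> 'a set set" where
  "Coz X = {topspace X - Z | Z. zero_set_in X Z}"

text \<open>
  A topological property is a predicate \<open>P\<close> on topologies; a subset of \<open>X\<close> has \<open>P\<close> if \<open>P\<close> holds
  of its subspace topology.
\<close>

definition P_separation ::
    "('a topology \<Rightarrow> bool) \<Rightarrow> 'a topology \<Rightarrow> 'a set \<Rightarrow> 'a set \<Rightarrow> bool" where
  "P_separation P X C D \<longleftrightarrow>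
     C \<in> Coz X \<and> D \<in> Coz X \<and> disjnt C D \<and>
     \<not> P (subtopology X (X closure_of C)) \<and>
     \<not> P (subtopology X (X closure_of D)) \<and>
     (\<exists>E \<in> Coz X. topspace X - (C \<union> D) \<subseteq> E \<and> P (subtopology X (X closure_of E)))"

definition P_disconnected :: "('a topology \<Rightarrow> bool) \<Rightarrow> 'a topology \<Rightarrow> bool" where
  "P_disconnected P X \<longleftrightarrow> (\<exists>C D. P_separation P X C D)"

definition P_connected :: "('a topology \<Rightarrow> bool) \<Rightarrow> 'a topology \<Rightarrow> bool" where
  "P_connected P X \<longleftrightarrow> \<not> P_disconnected P X"

text \<open>
  The Stone-Cech compactification of \<open>X\<close> is the closure of the image of \<open>X\<close> under the
  evaluation map into the cube whose coordinates are the continuous functions from \<open>X\<close> to the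
  unit interval. Extensionality selects one HOL function for each continuous function on the
  carrier of \<open>X\<close>.
\<close>

definition unit_interval_maps :: "'a topology \<Rightarrow> ('a \<Rightarrow> real) set" where
  "unit_interval_maps X =
     {f \<in> extensional (topspace X). continuous_map X (top_of_set {0..1}) f}"

definition tychonoff_cube :: "'a topology \<Rightarrow> (('a \<Rightarrow> real) \<Rightarrow> real) topology" where
  "tychonoff_cube X = product_topology (\<lambda>f. top_of_set {0..1}) (unit_interval_maps X)"

definition stone_cech_map :: "'a topology \<Rightarrow> 'a \<Rightarrow> ('a \<Rightarrow> real) \<Rightarrow> real" where
  "stone_cech_map X x = (\<lambda>f \<in> unit_interval_maps X. f x)"

definition stone_cech :: "'a topology \<Rightarrow> (('a \<Rightarrow> real) \<Rightarrow> real) topology" where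
  "stone_cech X =
     subtopology (tychonoff_cube X) (tychonoff_cube X closure_of (stone_cech_map X ` topspace X))"

text \<open>
  The inclusion of \<open>X\<close> in its compactification is rendered by the embedding \<open>stone_cech_map X\<close>, so
  the remainder is the complement of the image of \<open>X\<close>.
\<close>

definition stone_cech_remainder :: "'a topology \<Rightarrow> (('a \<Rightarrow> real) \<Rightarrow> real) topology" where
  "stone_cech_remainder X =
     subtopology (stone_cech X) (topspace (stone_cech X) - stone_cech_map X ` topspace X)"

text \<open>
  The following facts characterise the Stone-Cech compactification of a completely regular
  Hausdorff space among its compactifications.
\<close>

lemma compact_space_tychonoff_cube: "compact_space (tychonoff_cube X)"
  unfolding tychonoff_cube_def
  using compact_space_product_topology compact_space_subtopology compactin_euclidean_iff by blast

lemma Hausdorff_space_tychonoff_cube: "Hausdorff_space (tychonoff_cube X)"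
  unfolding tychonoff_cube_def
  using Hausdorff_space_euclidean Hausdorff_space_product_topology Hausdorff_space_subtopology
  by blast

lemma compact_space_stone_cech: "compact_space (stone_cech X)"
  unfolding stone_cech_def
  by (metis closedin_closure_of closedin_compact_space compact_space_subtopology
      compact_space_tychonoff_cube)

lemma Hausdorff_space_stone_cech: "Hausdorff_space (stone_cech X)"
  unfolding stone_cech_def
  by (simp add: Hausdorff_space_subtopology Hausdorff_space_tychonoff_cube)

lemma stone_cech_map_in_cube:
  "stone_cech_map X ` topspace X \<subseteq> topspace (tychonoff_cube X)"
  by (fastforce simp: stone_cech_map_def tychonoff_cube_def unit_interval_maps_def PiE_iff
      continuous_map_in_subtopology)

lemma topspace_stone_cech:
  "topspace (stone_cech X) = tychonoff_cube X closure_of (stone_cech_map X ` topspace X)"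
  by (simp add: stone_cech_def closure_of_subset_topspace inf_absorb2)

lemma stone_cech_map_subset: "stone_cech_map X ` topspace X \<subseteq> topspace (stone_cech X)"
  unfolding topspace_stone_cech by (simp add: closure_of_subset stone_cech_map_in_cube)

lemma stone_cech_dense:
  "stone_cech X closure_of (stone_cech_map X ` topspace X) = topspace (stone_cech X)"
proof -
  let ?A = "stone_cech_map X ` topspace X"
  have "?A \<subseteq> tychonoff_cube X closure_of ?A"
    using stone_cech_map_subset [of X] by (simp only: topspace_stone_cech)
  then have "tychonoff_cube X closure_of ?A \<inter> ?A = ?A"
    by blast
  then show ?thesis
    by (simp only: topspace_stone_cech) (simp add: stone_cech_def closure_of_subtopology)
qed

lemma embedding_map_stone_cech_map:
  assumes "completely_regular_space X" "Hausdorff_space X"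
  shows "embedding_map X (stone_cech X) (stone_cech_map X)"
proof -
  have K: "mspace (submetric (cfunspace X euclidean_metric) {f. f \<in> topspace X \<rightarrow> {0..1}})
             = unit_interval_maps X"
  proof -
    have "bounded (f ` topspace X)" if "f \<in> topspace X \<rightarrow> {0..1::real}" for f
      using that by (metis bounded_closed_interval bounded_subset image_subset_iff_funcset)
    then show ?thesis
      by (auto simp: unit_interval_maps_def continuous_map_in_subtopology Pi_iff)
  qed
  have "embedding_map X (tychonoff_cube X) (stone_cech_map X)"
    using completely_regular_space_cube_embedding_explicit [OF assms]
    unfolding K tychonoff_cube_def by (simp add: stone_cech_map_def [abs_def])
  then show ?thesis
    using stone_cech_map_subset [of X]
    by (simp add: embedding_map_in_subtopology stone_cech_def topspace_stone_cech
        image_subset_iff_funcset)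
qed

lemma stone_cech_extension:
  fixes f :: "'a \<Rightarrow> real"
  assumes "continuous_map X (top_of_set {0..1}) f"
  obtains g where "continuous_map (stone_cech X) (top_of_set {0..1}) g"
    and "\<And>x. x \<in> topspace X \<Longrightarrow> g (stone_cech_map X x) = f x"
proof
  let ?f = "restrict f (topspace X)"
  have f: "?f \<in> unit_interval_maps X"
    using assms by (auto simp: unit_interval_maps_def elim: continuous_map_eq)
  show "continuous_map (stone_cech X) (top_of_set {0..1}) (\<lambda>p. p ?f)"
    unfolding stone_cech_def tychonoff_cube_def
    by (rule continuous_map_from_subtopology continuous_map_product_projection f)+
  show "stone_cech_map X x ?f = f x" if "x \<in> topspace X" for x
    using that f by (simp add: stone_cech_map_def)
qed

end

theory Submission
  imports Defs
begin

text \<open>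
  Write \<open>i\<close> for the embedding of \<open>X\<close> into \<open>\<beta>X\<close>. A set \<open>S\<close> has compact closure in \<open>X\<close> exactly when the
  closure of \<open>i S\<close> in \<open>\<beta>X\<close> misses the remainder. Given a separation \<open>C, D\<close> with \<open>E\<close>, the sets \<open>C - E\<close>
  and \<open>D - E\<close> are disjoint zero-sets, so their closures in \<open>\<beta>X\<close> are disjoint, and these closures
  split the remainder into two non-empty closed parts. Conversely, the remainder is closed because
  \<open>X\<close> is locally compact; a Urysohn function on \<open>\<beta>X\<close> that is \<open>0\<close> on one part of a disconnected
  remainder and \<open>1\<close> on the other has level sets that yield a separation of \<open>X\<close>.
\<close>

text \<open>Truncating a non-negative function at 1 keeps its zero-set. Witnesses may therefore be
  unbounded, which leaves room to add them and form quotients later.\<close>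

lemma Coz_iff_positive_set:
  "C \<in> Coz X \<longleftrightarrow>
     (\<exists>f. continuous_map X euclideanreal f \<and> (\<forall>x \<in> topspace X. 0 \<le> f x) \<and>
          C = {x \<in> topspace X. 0 < f x})"
    (is "?lhs \<longleftrightarrow> ?rhs")
proof
  assume ?lhs
  then obtain f :: "'a \<Rightarrow> real" where f: "continuous_map X (top_of_set {0..1}) f"
      and C: "C = topspace X - {x \<in> topspace X. f x = 0}"
    by (auto simp: Coz_def zero_set_in_def)
  have "\<forall>x \<in> topspace X. 0 \<le> f x"
    using f by (force simp: continuous_map_in_subtopology)
  moreover from this have "C = {x \<in> topspace X. 0 < f x}"
    using C by force
  ultimately show ?rhs
    using f by (auto simp: continuous_map_in_subtopology)
next
  assume ?rhs
  then obtain f where f: "continuous_map X euclideanreal f"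
      and C: "C = {x \<in> topspace X. 0 < f x}"
    by blast
  let ?g = "\<lambda>x. min 1 (max 0 (f x))"
  have "continuous_map X euclideanreal ?g"
    by (intro continuous_intros f)
  then have "continuous_map X (top_of_set {0..1}) ?g"
    by (simp add: continuous_map_in_subtopology image_subset_iff)
  then have "zero_set_in X {x \<in> topspace X. ?g x = 0}"
    unfolding zero_set_in_def by blast
  moreover have "C = topspace X - {x \<in> topspace X. ?g x = 0}"
    unfolding C by (auto simp: min_def max_def split: if_splits)
  ultimately show ?lhs
    unfolding Coz_def by blast
qed

lemma Coz_positive_set:
  assumes "continuous_map X euclideanreal f"
  shows "{x \<in> topspace X. 0 < f x} \<in> Coz X"
proof -
  have "{x \<in> topspace X. 0 < f x} = {x \<in> topspace X. 0 < max 0 (f x)}"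
    by auto
  moreover have "continuous_map X euclideanreal (\<lambda>x. max 0 (f x))"
    using assms by (intro continuous_intros)
  ultimately show ?thesis
    unfolding Coz_iff_positive_set by (intro exI [of _ "\<lambda>x. max 0 (f x)"]) simp
qed

lemma continuous_map_stone_cech_map:
  assumes "completely_regular_space X" "Hausdorff_space X"
  shows "continuous_map X (stone_cech X) (stone_cech_map X)"
  using embedding_map_stone_cech_map [OF assms] continuous_map_into_fulltopology
    homeomorphic_imp_continuous_map
  unfolding embedding_map_def by blast

text \<open>Forwards, the image of the compact closure is compact, hence closed in the Hausdorff
  space \<beta>X, so it contains \<open>?cl\<close>. Backwards, \<open>?cl\<close> is compact and
  lies in the image of \<open>X\<close>, so it pulls back along the homeomorphism to a compact set
  \<open>T\<close> containing \<open>S\<close>; as \<open>X\<close> is Hausdorff, \<open>T\<close>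
  is closed and contains the closure of \<open>S\<close>.\<close>

lemma compactin_closure_of_iff_stone_cech:
  assumes "completely_regular_space X" "Hausdorff_space X" "S \<subseteq> topspace X"
  shows "compactin X (X closure_of S) \<longleftrightarrow>
           stone_cech X closure_of (stone_cech_map X ` S) \<subseteq> stone_cech_map X ` topspace X"
    (is "_ \<longleftrightarrow> ?cl \<subseteq> ?i ` _")
proof
  have emb: "embedding_map X (stone_cech X) ?i"
    by (rule embedding_map_stone_cech_map [OF assms(1,2)])
  {
    assume "compactin X (X closure_of S)"
    then have "compactin (stone_cech X) (?i ` (X closure_of S))"
      using continuous_map_stone_cech_map [OF assms(1,2)] image_compactin by blast
    then have "closedin (stone_cech X) (?i ` (X closure_of S))"
      by (simp add: Hausdorff_space_stone_cech compactin_imp_closedin)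
    then have "?cl \<subseteq> ?i ` (X closure_of S)"
      using assms(3) by (intro closure_of_minimal image_mono closure_of_subset)
    then show "?cl \<subseteq> ?i ` topspace X"
      using closure_of_subset_topspace by fast
  next
    assume sub: "?cl \<subseteq> ?i ` topspace X"
    define T where "T = {x \<in> topspace X. ?i x \<in> ?cl}"
    have T_sub: "T \<subseteq> topspace X"
      by (auto simp: T_def)
    have hom: "homeomorphic_map X (subtopology (stone_cech X) (?i ` topspace X)) ?i"
      using emb by (simp add: embedding_map_def)
    have "compactin (stone_cech X) ?cl"
      by (simp add: closedin_compact_space compact_space_stone_cech)
    moreover have "?i ` T = ?cl"
      using sub by (auto simp: T_def)
    ultimately have "compactin (subtopology (stone_cech X) (?i ` topspace X)) (?i ` T)"
      using sub by (simp add: compactin_subtopology)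
    then have "compactin X T"
      using homeomorphic_map_compactness [OF hom] T_sub by blast
    moreover have "S \<subseteq> T"
    proof -
      have "?i ` S \<subseteq> ?cl"
        using image_mono [OF assms(3)] stone_cech_map_subset
        by (intro closure_of_subset) (rule order_trans)
      then show ?thesis
        using assms(3) by (auto simp: T_def)
    qed
    ultimately show "compactin X (X closure_of S)"
      using assms(2)
      by (meson closed_compactin closedin_closure_of closure_of_minimal compactin_imp_closedin)
  }
qed

text \<open>A dense locally compact subspace of a Hausdorff space is open, and the image of
  \<open>X\<close> is such a subspace of \<beta>X.\<close>

lemma closedin_stone_cech_remainder:
  assumes "locally_compact_space X" "Hausdorff_space X"
  shows "closedin (stone_cech X) (topspace (stone_cech X) - stone_cech_map X ` topspace X)"
proof -
  have "embedding_map X (stone_cech X) (stone_cech_map X)"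
    using assms
    by (simp add: embedding_map_stone_cech_map locally_compact_regular_imp_completely_regular_space)
  then have "X homeomorphic_space
               subtopology (stone_cech X) (stone_cech_map X ` topspace X)"
    using embedding_map_imp_homeomorphic_space by blast
  then have "locally_compact_space (subtopology (stone_cech X) (stone_cech_map X ` topspace X))"
    using assms(1) homeomorphic_locally_compact_space by blast
  then have "openin (stone_cech X) (stone_cech_map X ` topspace X)"
    by (simp add: Hausdorff_space_stone_cech dense_locally_compact_openin_Hausdorff_space
        stone_cech_dense stone_cech_map_subset)
  then show ?thesis
    by blast
qed

lemma P_disconnected_imp_not_connected_remainder:
  assumes cr: "completely_regular_space X" and H: "Hausdorff_space X"
    and "P_disconnected compact_space X"
  shows "\<not> connected_space (stone_cech_remainder X)"
proof -
  let ?B = "stone_cech X" and ?i = "stone_cech_map X"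
  let ?R = "topspace ?B - ?i ` topspace X"
  obtain C D E where CDE: "C \<in> Coz X" "D \<in> Coz X" "E \<in> Coz X" and CD: "disjnt C D"
    and ncC: "\<not> compact_space (subtopology X (X closure_of C))"
    and ncD: "\<not> compact_space (subtopology X (X closure_of D))"
    and cover: "topspace X - (C \<union> D) \<subseteq> E"
    and cE: "compact_space (subtopology X (X closure_of E))"
    using assms(3) unfolding P_disconnected_def P_separation_def by blast
  obtain f where f: "continuous_map X euclideanreal f" "\<forall>x \<in> topspace X. 0 \<le> f x"
    and C: "C = {x \<in> topspace X. 0 < f x}"
    using CDE(1) unfolding Coz_iff_positive_set by blast
  obtain g where g: "continuous_map X euclideanreal g" "\<forall>x \<in> topspace X. 0 \<le> g x"
    and D: "D = {x \<in> topspace X. 0 < g x}"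
    using CDE(2) unfolding Coz_iff_positive_set by blast
  obtain e where e: "continuous_map X euclideanreal e" "\<forall>x \<in> topspace X. 0 \<le> e x"
    and E: "E = {x \<in> topspace X. 0 < e x}"
    using CDE(3) unfolding Coz_iff_positive_set by blast
  have sub: "C \<subseteq> topspace X" "D \<subseteq> topspace X" "E \<subseteq> topspace X"
    by (auto simp: C D E)
  \<comment> \<open>The zero-sets of \<open>e + g\<close> and \<open>e + f\<close> are
    \<open>C - E\<close> and \<open>D - E\<close>. They are disjoint because \<open>C\<close>,
    \<open>D\<close> and \<open>E\<close> cover \<open>X\<close>, so the denominator never vanishes;
    \<open>?u\<close> is 0 on the first and 1 on the second.\<close>
  let ?u = "\<lambda>x. (e x + g x) / ((e x + g x) + (e x + f x))"
  have pos: "0 < (e x + g x) + (e x + f x)" if "x \<in> topspace X" for x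
  proof -
    have "0 < f x \<or> 0 < g x \<or> 0 < e x"
      using that cover by (auto simp: C D E)
    then show ?thesis
      using that e(2) f(2) g(2) by (smt (verit, best))
  qed
  have "continuous_map X euclideanreal ?u"
    using pos by (intro continuous_intros e f g) force
  moreover have "?u x \<in> {0..1}" if "x \<in> topspace X" for x
    using that pos [OF that] e(2) f(2) g(2) by (simp add: divide_simps)
  ultimately have "continuous_map X (top_of_set {0..1}) ?u"
    by (auto simp: continuous_map_in_subtopology)
  \<comment> \<open>The extension of \<open>?u\<close> to \<beta>X places the closures of the two
    images in the disjoint closed level sets of 0 and 1.\<close>
  then obtain U where U: "continuous_map ?B (top_of_set {0..1}) U"
    and Ui: "\<And>x. x \<in> topspace X \<Longrightarrow> U (?i x) = ?u x"
    using stone_cech_extension by blast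
  have level: "closedin ?B {p \<in> topspace ?B. U p = c}" for c
  proof -
    have "closedin ?B {p \<in> topspace ?B. U p \<in> {c}}"
      using U by (intro closedin_continuous_map_preimage [where Y = euclideanreal])
        (auto simp: continuous_map_in_subtopology)
    then show ?thesis by simp
  qed
  define K where "K S = ?B closure_of (?i ` S)" for S
  have "U (?i x) = 0" if "x \<in> C - E" for x
  proof -
    have "x \<in> topspace X" "e x = 0" "g x = 0"
      using that CD e(2) g(2) by (force simp: C D E disjnt_iff)+
    then show ?thesis by (simp add: Ui)
  qed
  then have KC: "K (C - E) \<subseteq> {p \<in> topspace ?B. U p = 0}"
    unfolding K_def using sub stone_cech_map_subset [of X]
    by (intro closure_of_minimal level) blast
  have "U (?i x) = 1" if "x \<in> D - E" for x
  proof -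
    have "x \<in> topspace X" "e x = 0" "f x = 0"
      using that CD e(2) f(2) by (force simp: C D E disjnt_iff)+
    then show ?thesis using pos by (force simp: Ui)
  qed
  then have KD: "K (D - E) \<subseteq> {p \<in> topspace ?B. U p = 1}"
    unfolding K_def using sub stone_cech_map_subset [of X]
    by (intro closure_of_minimal level) blast
  have KE: "K E \<inter> ?R = {}"
    using compactin_closure_of_iff_stone_cech [OF cr H sub(3)] cE
    by (auto simp: K_def compactin_subspace closure_of_subset_topspace)
  have Un: "K (S \<union> T) = K S \<union> K T" for S T
    by (simp add: K_def image_Un)
  have mono: "K S \<subseteq> K T" if "S \<subseteq> T" for S T
    unfolding K_def using that by (intro closure_of_mono image_mono)
  \<comment> \<open>Removing \<open>E\<close> from \<open>S\<close> loses no point of the remainder,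
    since \<open>K S\<close> lies in \<open>K (S - E)\<close> together with \<open>K E\<close>, and
    the latter misses \<open>?R\<close>.\<close>
  have meets: "K (S - E) \<inter> ?R \<noteq> {}"
    if "S \<subseteq> topspace X" "\<not> compact_space (subtopology X (X closure_of S))" for S
  proof -
    have "\<not> K S \<subseteq> ?i ` topspace X"
      using compactin_closure_of_iff_stone_cech [OF cr H that(1)] that(2)
      by (simp add: K_def compactin_subspace closure_of_subset_topspace)
    then have "K S \<inter> ?R \<noteq> {}"
      using closure_of_subset_topspace [of ?B "?i ` S"] by (auto simp: K_def)
    moreover have "K S \<subseteq> K (S - E) \<union> K E"
      unfolding Un [symmetric] by (intro mono) blast
    ultimately show ?thesis
      using KE by blast
  qed
  \<comment> \<open>By density, the cover of \<open>X\<close> by \<open>C - E\<close>,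
    \<open>D - E\<close> and \<open>E\<close> becomes a cover of \<beta>X by closures; on the
    remainder only the first two count.\<close>
  have "topspace ?B = K (topspace X)"
    by (simp add: K_def stone_cech_dense)
  also have "\<dots> \<subseteq> K (C - E) \<union> K (D - E) \<union> K E"
    unfolding Un [symmetric] using cover by (intro mono) blast
  finally have "?R \<subseteq> (?R \<inter> K (C - E)) \<union> (?R \<inter> K (D - E))"
    using KE by blast
  moreover have "closedin (stone_cech_remainder X) (?R \<inter> K S)" for S
    unfolding stone_cech_remainder_def K_def by (simp add: closedin_subtopology_Int_closed)
  moreover have "(?R \<inter> K (C - E)) \<inter> (?R \<inter> K (D - E)) = {}"
    using KC KD by force
  moreover have "?R \<inter> K (C - E) \<noteq> {}" "?R \<inter> K (D - E) \<noteq> {}"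
    using meets sub ncC ncD by blast+
  moreover have "topspace (stone_cech_remainder X) = ?R"
    by (auto simp: stone_cech_remainder_def)
  ultimately show ?thesis
    unfolding connected_space_closedin by metis
qed

lemma not_connected_remainder_imp_P_disconnected:
  assumes lc: "locally_compact_space X" and H: "Hausdorff_space X"
    and "\<not> connected_space (stone_cech_remainder X)"
  shows "P_disconnected compact_space X"
proof -
  let ?B = "stone_cech X" and ?i = "stone_cech_map X"
  let ?R = "topspace ?B - ?i ` topspace X"
  have cr: "completely_regular_space X"
    using lc H by (simp add: locally_compact_regular_imp_completely_regular_space)
  have R: "closedin ?B ?R"
    by (rule closedin_stone_cech_remainder [OF lc H])
  obtain A A' where A: "closedin (subtopology ?B ?R) A" "closedin (subtopology ?B ?R) A'"
    and AA': "A \<union> A' = topspace (subtopology ?B ?R)" "A \<inter> A' = {}" "A \<noteq> {}" "A' \<noteq> {}"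
    using assms(3) unfolding connected_space_closedin_eq stone_cech_remainder_def by blast
  \<comment> \<open>Closedness of the remainder makes both parts closed in \<beta>X itself, as the
    Urysohn lemma requires.\<close>
  have "closedin ?B A" "closedin ?B A'"
    using A R closedin_trans_full by blast+
  moreover have "normal_space ?B"
    by (simp add: Hausdorff_space_stone_cech compact_Hausdorff_or_regular_imp_normal_space
        compact_space_stone_cech)
  ultimately obtain U where U: "continuous_map ?B euclideanreal U"
    and UA: "U ` A \<subseteq> {0}" "U ` A' \<subseteq> {1::real}"
    using AA'(2) Urysohn_lemma_alt [of ?B A A' 0 1] by (metis disjnt_def)
  have RU: "?R = A \<union> A'"
    using AA'(1) by auto
  let ?u = "U \<circ> ?i"
  have u: "continuous_map X euclideanreal ?u"
    using continuous_map_stone_cech_map [OF cr H] U by (rule continuous_map_compose)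
  \<comment> \<open>In terms of \<open>?u\<close> these are the sets below 1/3, above 2/3, and
    strictly between 1/4 and 3/4. The third overlaps the other two, so all of \<open>X\<close> is
    covered, yet it stays away from the values 0 and 1.\<close>
  define C where "C = {x \<in> topspace X. 0 < 1/3 - ?u x}"
  define D where "D = {x \<in> topspace X. 0 < ?u x - 2/3}"
  define E where "E = {x \<in> topspace X. 0 < 1/4 - \<bar>?u x - 1/2\<bar>}"
  have not_compact: "\<not> compact_space (subtopology X (X closure_of S))"
    if S: "S = {x \<in> topspace X. U (?i x) \<in> T}" and T: "open T" "p \<in> ?R" "U p \<in> T"
    for S T p
  proof
    assume "compact_space (subtopology X (X closure_of S))"
    moreover have "S \<subseteq> topspace X"
      by (auto simp: S)
    ultimately have sub: "?B closure_of (?i ` S) \<subseteq> ?i ` topspace X"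
      using compactin_closure_of_iff_stone_cech [OF cr H]
      by (simp add: compactin_subspace closure_of_subset_topspace)
    let ?V = "{q \<in> topspace ?B. U q \<in> T}"
    have "openin ?B ?V"
      using U T(1) by (intro openin_continuous_map_preimage) auto
    then have "?V \<inter> ?B closure_of (?i ` topspace X) \<subseteq> ?B closure_of (?V \<inter> ?i ` topspace X)"
      by (rule openin_Int_closure_of_subset)
    moreover have "?V \<inter> ?i ` topspace X \<subseteq> ?i ` S"
      by (auto simp: S)
    ultimately have "?V \<subseteq> ?B closure_of (?i ` S)"
      unfolding stone_cech_dense using closure_of_mono [of "?V \<inter> ?i ` topspace X" "?i ` S" ?B]
      by blast
    then show False
      using sub T by blast
  qed
  obtain p p' where "p \<in> A" "p' \<in> A'"
    using AA' by blast
  then have p: "p \<in> ?R" "U p = 0" "p' \<in> ?R" "U p' = 1"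
    using RU UA by blast+
  have "C \<in> Coz X" "D \<in> Coz X" "E \<in> Coz X"
    unfolding C_def D_def E_def by (intro Coz_positive_set continuous_intros u)+
  moreover have "disjnt C D"
    by (auto simp: C_def D_def disjnt_iff)
  moreover have "topspace X - (C \<union> D) \<subseteq> E"
    by (auto simp: C_def D_def E_def abs_if)
  moreover have "compact_space (subtopology X (X closure_of E))"
  proof -
    \<comment> \<open>On the remainder \<open>U\<close> takes only the values 0 and 1, so this
      closed band around 1/2 lies inside the image of \<open>X\<close>.\<close>
    let ?L = "{p \<in> topspace ?B. U p \<in> {1/4..3/4}}"
    have "closedin ?B ?L"
      using U by (rule closedin_continuous_map_preimage) simp
    moreover have "?i ` E \<subseteq> ?L"
      using stone_cech_map_subset [of X] by (auto simp: E_def abs_if split: if_splits)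
    ultimately have "?B closure_of (?i ` E) \<subseteq> ?L"
      by (intro closure_of_minimal)
    moreover have "?L \<subseteq> ?i ` topspace X"
    proof (intro subsetI, rule ccontr)
      fix p
      assume p: "p \<in> ?L" "p \<notin> ?i ` topspace X"
      then have "p \<in> A \<union> A'"
        unfolding RU [symmetric] by simp
      then have "U p = 0 \<or> U p = 1"
        using UA by blast
      then show False
        using p(1) by auto
    qed
    ultimately have "?B closure_of (?i ` E) \<subseteq> ?i ` topspace X"
      by (rule order_trans)
    moreover have "E \<subseteq> topspace X"
      by (auto simp: E_def)
    ultimately show ?thesis
      using compactin_closure_of_iff_stone_cech [OF cr H] compactin_subspace by blast
  qed
  moreover have "\<not> compact_space (subtopology X (X closure_of C))"
    \<comment> \<open>The points \<open>p\<close> and \<open>p'\<close> from the two parts witness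
      non-compactness, at the values 0 and 1.\<close>
    using p by (intro not_compact [where T = "{..<1/3}" and p = p]) (auto simp: C_def)
  moreover have "\<not> compact_space (subtopology X (X closure_of D))"
    using p by (intro not_compact [where T = "{2/3<..}" and p = p']) (auto simp: D_def)
  ultimately show ?thesis
    unfolding P_disconnected_def P_separation_def by blast
qed

theorem theorem3p12:
  fixes X :: "'a topology"
  assumes "locally_compact_space X" and "Hausdorff_space X"
  shows "P_connected compact_space X \<longleftrightarrow> connected_space (stone_cech_remainder X)"
  using assms P_disconnected_imp_not_connected_remainder [of X]
    not_connected_remainder_imp_P_disconnected [of X]
  by (auto simp: P_connected_def locally_compact_regular_imp_completely_regular_space)

end
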